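(* Let $G$ be a countable discrete amenable group, $(V,\|\cdot\|)$ a complete semi-normed (real) vector space, and $\pi: G \to \mathrm{Isom}(V)$ a uniformly bounded representation. Let $U$ be a subspace of $V$ such that $U \subseteq \overline{\mathcal{L}}$. Consider the map $\hat{S}: V/U \to [\mathcal{M}_\oplus]_{\mathcal{N}}$ given by $\hat{S}(v + U) = S(v) + \mathcal{N}$. Then $\hat{S}$ is a surjective and continuous linear transformation from $(V/U,\|\cdot\|_U)$ onto $([\mathcal{M}_\oplus]_{\mathcal{N}}, |||\cdot|||_{\mathcal{N}})$. Moreover, if $U = \overline{\mathcal{L}}$, then $\hat{S}$ is a linear isomorphism and if, additionally, $\pi$ is isometric, then $\hat{S}$ is an isometry.
   Context: $\mathcal{F}(G)$ is the set of non-empty finite subsets of $G$. For $K\in\mathcal{F}(G)$ and $\delta>0$, $F\in\mathcal{F}(G)$ is $(K,\delta)$-invariant if $|KF\,\Delta\, F|\le \delta|F|$; $G$ is amenable if a $(K,\delta)$-invariant set exists for every $(K,\delta)\in\mathcal{F}(G)\times\mathbb{R}_{>0}$. For $\rho:\mathcal{F}(G)\to\mathbb{R}$, $\limsup_{F\to G}\rho(F):=\inf_{(K,\delta)}\sup\{\rho(F): F \text{ is } (K,\delta)\text{-invariant}\}$. $V$ is complete: every $\|\cdot\|$-Cauchy sequence has a $\|\cdot\|$-limit in $V$. $\mathrm{Isom}(V)$ denotes the group of bounded invertible linear operators on $V$ (not necessarily isometries); a representation is a group homomorphism $\pi:G\to\mathrm{Isom}(V)$; it is uniformly bounded if $C_\pi:=\sup_{g\in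 G}\|\pi(g)\|_{\mathrm{op}}<\infty$, and isometric if $C_\pi=1$, equivalently if each $\pi(g)$ is an isometry. $\mathcal{L}$ is the linear span of $\{v-\pi(g)v: v\in V, g\in G\}$ and $\overline{\mathcal{L}}$ its $\|\cdot\|$-closure. For a subspace $U$, $\|v+U\|_U=\inf_{u\in U}\|v+u\|$ is the quotient semi-norm on $V/U$. A set map is a function $\varphi:\mathcal{F}(G)\to V$. $\mathcal{M}$ is the space of set maps that are bounded, $\sup_F\|\varphi(F)/|F|\|<\infty$, and $G$-equivariant, $\pi(g)\varphi(F)=\varphi(Fg^{-1})$ for all $g\in G$, $F\in\mathcal{F}(G)$. $\mathcal{M}_\oplus\subseteq\mathcal{M}$ is the subspace of additive maps, i.e. $\varphi(E\sqcup F)=\varphi(E)+\varphi(F)$ for disjoint $E,F\in\mathcal{F}(G)$. $|||\varphi|||_G:=\limsup_{F\to G}\|\varphi(F)/|F|\|$ is a semi-norm on $\mathcal{M}$ and $\mathcal{N}=\{\varphi\in\mathcal{M}:|||\varphi|||_G=0\}$ its kernel. On $\mathcal{M}/\mathcal{N}$ one has the norm $|||\varphi+\mathcal{N}|||_{\mathcal{N}}=|||\varphi|||_G$, and $[\mathcal{M}_\oplus]_{\mathcal{N}}=\{\psi+\mathcal{N}:\psi\in\mathcal{M}_\oplus\}\subseteq\mathcal{M}/\mathcal{N}$. $S(v)$ is the additive set map $S(v)(F)=\sum_{g\in F}\pi(g^{-1})v$. A linear isomorphism means a linear bijection that is continuous with continuous inverse. *)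

theory Defs
  imports
    "HOL-Analysis.Abstract_Topology"
    "HOL-Algebra.Coset"
    "HOL-Library.Function_Algebras"
    "HOL-Library.Set_Algebras"
    "HOL-Library.Countable_Set"
begin

section \<open>Semi-normed spaces\<close>

definition is_seminorm :: "('v::real_vector \<Rightarrow> real) \<Rightarrow> bool" where
  "is_seminorm p \<longleftrightarrow>
     (\<forall>x y. p (x + y) \<le> p x + p y) \<and> (\<forall>c x. p (c *\<^sub>R x) = \<bar>c\<bar> * p x)"

definition seminorm_complete :: "('v::real_vector \<Rightarrow> real) \<Rightarrow> bool" where
  "seminorm_complete p \<longleftrightarrow>
     (\<forall>X :: nat \<Rightarrow> 'v.
        (\<forall>e>0. \<exists>N. \<forall>m\<ge>N. \<forall>n\<ge>N. p (X m - X n) < e) \<longrightarrow>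
        (\<exists>l. (\<lambda>n. p (X n - l)) \<longlonglongrightarrow> 0))"

text \<open>The topology on the set \<open>X\<close> induced by a pseudo-distance \<open>d\<close>.\<close>

definition pseudodist_topology :: "'a set \<Rightarrow> ('a \<Rightarrow> 'a \<Rightarrow> real) \<Rightarrow> 'a topology" where
  "pseudodist_topology X d =
     topology (\<lambda>W. W \<subseteq> X \<and> (\<forall>x\<in>W. \<exists>e>0. \<forall>y\<in>X. d x y < e \<longrightarrow> y \<in> W))"

lemma openin_pseudodist_topology:
  "openin (pseudodist_topology X d) W \<longleftrightarrow>
     W \<subseteq> X \<and> (\<forall>x\<in>W. \<exists>e>0. \<forall>y\<in>X. d x y < e \<longrightarrow> y \<in> W)"
proof -
  let ?P = "\<lambda>W. W \<subseteq> X \<and> (\<forall>x\<in>W. \<exists>e>0. \<forall>y\<in>X. d x y < e \<longrightarrow> y \<in> W)"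
  have "?P (S \<inter> T)" if S: "?P S" and T: "?P T" for S T
  proof (intro conjI ballI)
    fix x assume "x \<in> S \<inter> T"
    with S T obtain e1 e2 where
      "e1 > 0" "\<forall>y\<in>X. d x y < e1 \<longrightarrow> y \<in> S" "e2 > 0" "\<forall>y\<in>X. d x y < e2 \<longrightarrow> y \<in> T"
      by blast
    then show "\<exists>e>0. \<forall>y\<in>X. d x y < e \<longrightarrow> y \<in> S \<inter> T"
      by (intro exI[of _ "min e1 e2"]) auto
  qed (use S in blast)
  moreover have "?P (\<Union>K)" if "\<forall>S\<in>K. ?P S" for K
    using that by (auto; meson)
  ultimately have "istopology ?P"
    unfolding istopology_def by blast
  then show ?thesis
    by (simp add: pseudodist_topology_def topology_inverse')
qed

abbreviation seminorm_topology :: "('v::real_vector \<Rightarrow> real) \<Rightarrow> 'v topology" where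
  "seminorm_topology p \<equiv> pseudodist_topology UNIV (\<lambda>x y. p (x - y))"


section \<open>Quotients of subspaces\<close>

text \<open>
  For subspaces \<open>U \<subseteq> W\<close> of a real vector space, the elements of \<open>W / U\<close> are the cosets
  \<open>w +o U\<close>. Addition of cosets is the elementwise sum \<open>A + B\<close> of sets from
  \<^theory>\<open>HOL-Library.Set_Algebras\<close>; adding \<open>U\<close> in the scalar multiplication is only needed for
  \<open>c = 0\<close>. Note that \<open>A - B\<close> denotes set difference, not subtraction of cosets.
\<close>

definition quotient_space :: "'v::real_vector set \<Rightarrow> 'v set \<Rightarrow> 'v set set" where
  "quotient_space W U = (\<lambda>w. w +o U) ` W"

definition coset_scale :: "'v::real_vector set \<Rightarrow> real \<Rightarrow> 'v set \<Rightarrow> 'v set" where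
  "coset_scale U c A = (\<lambda>a. c *\<^sub>R a) ` A + U"

definition coset_diff :: "'v::real_vector set \<Rightarrow> 'v set \<Rightarrow> 'v set \<Rightarrow> 'v set" where
  "coset_diff U A B = A + coset_scale U (- 1) B"

lemma coset_operations:
  fixes U :: "'v::real_vector set"
  assumes "subspace U"
  shows "(v +o U) + (w +o U) = (v + w) +o U"
    and "coset_scale U c (v +o U) = (c *\<^sub>R v) +o U"
    and "coset_diff U (v +o U) (w +o U) = (v - w) +o U"
proof -
  note U = subspace_0[OF assms] subspace_add[OF assms] subspace_scale[OF assms]
  have add: "(v +o U) + (w +o U) = (v + w) +o U" for v w
  proof -
    have "U + U = U"
      using U by (force simp: set_plus_def)
    then show ?thesis
      by (simp add: set_plus_rearrange)
  qed
  have scale: "coset_scale U c (v +o U) = (c *\<^sub>R v) +o U" for c v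
  proof
    show "coset_scale U c (v +o U) \<subseteq> (c *\<^sub>R v) +o U"
      using U by (force simp: coset_scale_def set_plus_def elt_set_plus_def scaleR_add_right add.assoc)
    show "(c *\<^sub>R v) +o U \<subseteq> coset_scale U c (v +o U)"
      using U(1) by (force simp: coset_scale_def set_plus_def elt_set_plus_def)
  qed
  show "(v +o U) + (w +o U) = (v + w) +o U" by (rule add)
  show "coset_scale U c (v +o U) = (c *\<^sub>R v) +o U" by (rule scale)
  show "coset_diff U (v +o U) (w +o U) = (v - w) +o U"
    by (simp add: coset_diff_def scale add)
qed

text \<open>
  \<open>T\<close> is linear as a map from a space \<open>X\<close> of \<open>U\<close>-cosets to a space of \<open>N\<close>-cosets.
\<close>

definition coset_linear ::
  "'v::real_vector set \<Rightarrow> 'w::real_vector set \<Rightarrow> 'v set set \<Rightarrow> ('v set \<Rightarrow> 'w set) \<Rightarrow> bool" where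
  "coset_linear U N X T \<longleftrightarrow>
     (\<forall>A\<in>X. \<forall>B\<in>X. T (A + B) = T A + T B) \<and>
     (\<forall>c. \<forall>A\<in>X. T (coset_scale U c A) = coset_scale N c (T A))"

text \<open>The topology on a space \<open>X\<close> of \<open>U\<close>-cosets given by a semi-norm \<open>q\<close> on cosets.\<close>

definition coset_topology ::
  "'v::real_vector set \<Rightarrow> 'v set set \<Rightarrow> ('v set \<Rightarrow> real) \<Rightarrow> 'v set topology" where
  "coset_topology U X q = pseudodist_topology X (\<lambda>A B. q (coset_diff U A B))"

text \<open>
  The quotient semi-norm: for \<open>A = v +o U\<close> this is the infimum of \<open>p (v + u)\<close> over \<open>u \<in> U\<close>.
\<close>

definition quotient_seminorm :: "('v \<Rightarrow> real) \<Rightarrow> 'v set \<Rightarrow> real" where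
  "quotient_seminorm p A = (INF a\<in>A. p a)"


section \<open>Uniformly bounded representations\<close>

definition bounded_operator :: "('v::real_vector \<Rightarrow> real) \<Rightarrow> ('v \<Rightarrow> 'v) \<Rightarrow> bool" where
  "bounded_operator p T \<longleftrightarrow> linear T \<and> (\<exists>C. \<forall>v. p (T v) \<le> C * p v)"

definition opnorm :: "('v::real_vector \<Rightarrow> real) \<Rightarrow> ('v \<Rightarrow> 'v) \<Rightarrow> real" where
  "opnorm p T = (SUP v\<in>{v. p v \<le> 1}. p (T v))"

definition Isom :: "('v::real_vector \<Rightarrow> real) \<Rightarrow> ('v \<Rightarrow> 'v) monoid" where
  "Isom p =
     \<lparr>carrier = {T. bounded_operator p T \<and> bij T \<and> bounded_operator p (inv_into UNIV T)},
      mult = (\<circ>), one = id\<rparr>"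

definition uniformly_bounded ::
  "('g, 'm) monoid_scheme \<Rightarrow> ('v::real_vector \<Rightarrow> real) \<Rightarrow> ('g \<Rightarrow> 'v \<Rightarrow> 'v) \<Rightarrow> bool" where
  "uniformly_bounded G p \<pi> \<longleftrightarrow> bdd_above ((\<lambda>g. opnorm p (\<pi> g)) ` carrier G)"

definition rep_bound ::
  "('g, 'm) monoid_scheme \<Rightarrow> ('v::real_vector \<Rightarrow> real) \<Rightarrow> ('g \<Rightarrow> 'v \<Rightarrow> 'v) \<Rightarrow> real" where
  "rep_bound G p \<pi> = (SUP g\<in>carrier G. opnorm p (\<pi> g))"

text \<open>
  A representation is isometric if each \<open>\<pi> g\<close> is an isometry. This is equivalent to
  \<open>rep_bound G p \<pi> = 1\<close>, see \<open>isometric_rep_iff\<close> below, except if \<open>p\<close> vanishes identically: then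
  every \<open>\<pi> g\<close> is an isometry while \<open>rep_bound G p \<pi> = 0\<close>.
\<close>

definition isometric_rep ::
  "('g, 'm) monoid_scheme \<Rightarrow> ('v::real_vector \<Rightarrow> real) \<Rightarrow> ('g \<Rightarrow> 'v \<Rightarrow> 'v) \<Rightarrow> bool" where
  "isometric_rep G p \<pi> \<longleftrightarrow> (\<forall>g\<in>carrier G. \<forall>v. p (\<pi> g v) = p v)"

lemma seminorm_nonneg:
  assumes "is_seminorm p"
  shows "p v \<ge> 0"
proof -
  have "p 0 = 0"
    using assms unfolding is_seminorm_def by (metis abs_zero mult_zero_left scaleR_zero_left)
  moreover have "p (- v) = p v"
    using assms unfolding is_seminorm_def
    by (metis abs_minus_cancel abs_one mult_1 scaleR_minus1_left)
  moreover have "p (v + - v) \<le> p v + p (- v)"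
    using assms unfolding is_seminorm_def by blast
  ultimately show ?thesis by simp
qed

lemma group_Isom:
  fixes p :: "'v::real_vector \<Rightarrow> real"
  assumes p: "is_seminorm p"
  shows "group (Isom p)"
proof (rule groupI)
  have comp: "bounded_operator p (S \<circ> T)"
    if S: "bounded_operator p S" and T: "bounded_operator p T" for S T :: "'v \<Rightarrow> 'v"
  proof -
    obtain A B where A: "\<And>v. p (S v) \<le> A * p v" and B: "\<And>v. p (T v) \<le> B * p v"
      using S T unfolding bounded_operator_def by blast
    have "p (S (T v)) \<le> (\<bar>A\<bar> * B) * p v" for v
    proof -
      have "p (S (T v)) \<le> A * p (T v)" by (rule A)
      also have "\<dots> \<le> \<bar>A\<bar> * p (T v)"
        by (intro mult_right_mono seminorm_nonneg p) auto
      also have "\<dots> \<le> \<bar>A\<bar> * (B * p v)"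
        by (intro mult_left_mono B) auto
      finally show ?thesis by (simp add: mult.assoc)
    qed
    then show ?thesis
      using S T unfolding bounded_operator_def by (auto intro: linear_compose)
  qed
  have id: "bounded_operator p id"
    unfolding bounded_operator_def by (auto intro!: exI[of _ 1] linear_id)
  show "x \<otimes>\<^bsub>Isom p\<^esub> y \<in> carrier (Isom p)"
    if "x \<in> carrier (Isom p)" "y \<in> carrier (Isom p)" for x y
    using that by (auto simp: Isom_def o_inv_distrib intro!: comp intro: bij_comp)
  show "\<one>\<^bsub>Isom p\<^esub> \<in> carrier (Isom p)"
    using id by (simp add: Isom_def)
  show "\<exists>y\<in>carrier (Isom p). y \<otimes>\<^bsub>Isom p\<^esub> x = \<one>\<^bsub>Isom p\<^esub>" if "x \<in> carrier (Isom p)" for x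
    using that
    by (intro bexI[of _ "inv_into UNIV x"])
       (auto simp: Isom_def bij_imp_bij_inv inv_inv_eq bij_is_inj)
qed (auto simp: Isom_def o_assoc)

lemma isometric_rep_iff:
  fixes p :: "'v::real_vector \<Rightarrow> real"
  assumes G: "group G" and p: "is_seminorm p" and \<pi>: "\<pi> \<in> hom G (Isom p)"
    and bdd: "uniformly_bounded G p \<pi>" and nz: "p w \<noteq> 0"
  shows "isometric_rep G p \<pi> \<longleftrightarrow> rep_bound G p \<pi> = 1"
proof
  interpret group G by (rule G)
  have pos: "p w > 0" using seminorm_nonneg[OF p, of w] nz by simp
  assume iso: "isometric_rep G p \<pi>"
  have "(SUP v\<in>{v. p v \<le> 1}. p v) = 1"
  proof (rule cSup_eq_maximum)
    have "p (inverse (p w) *\<^sub>R w) = 1"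
      using p pos by (simp add: is_seminorm_def)
    then show "1 \<in> p ` {v. p v \<le> 1}"
      by (intro image_eqI[of _ _ "inverse (p w) *\<^sub>R w"]) auto
  qed auto
  then have "opnorm p (\<pi> g) = 1" if "g \<in> carrier G" for g
    using iso that by (simp add: isometric_rep_def opnorm_def)
  then have "(\<lambda>g. opnorm p (\<pi> g)) ` carrier G = {1}"
    using one_closed by (auto simp: image_iff)
  then show "rep_bound G p \<pi> = 1"
    by (simp add: rep_bound_def)
next
  interpret group G by (rule G)
  assume C: "rep_bound G p \<pi> = 1"
  have sc: "p (c *\<^sub>R v) = \<bar>c\<bar> * p v" for c v
    using p unfolding is_seminorm_def by blast
  have le: "p (\<pi> g v) \<le> p v" if g: "g \<in> carrier G" for g v
  proof -
    have op: "bounded_operator p (\<pi> g)"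
      using \<pi> g by (auto simp: hom_def Isom_def)
    then obtain A where A: "\<And>v. p (\<pi> g v) \<le> A * p v"
      unfolding bounded_operator_def by blast
    have lin: "\<pi> g (c *\<^sub>R v) = c *\<^sub>R \<pi> g v" for c v
      using op unfolding bounded_operator_def by (auto intro: linear_scale)
    show ?thesis
    proof (cases "p v = 0")
      case True
      then show ?thesis using A[of v] by simp
    next
      case False
      then have v: "p v > 0" using seminorm_nonneg[OF p, of v] by simp
      have "p (\<pi> g u) \<le> \<bar>A\<bar>" if "p u \<le> 1" for u
      proof -
        have "A * p u \<le> \<bar>A\<bar> * p u"
          by (intro mult_right_mono seminorm_nonneg p) auto
        also have "\<dots> \<le> \<bar>A\<bar> * 1" using that by (intro mult_left_mono) auto
        finally show ?thesis using A[of u] by simp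
      qed
      then have "bdd_above ((\<lambda>v. p (\<pi> g v)) ` {v. p v \<le> 1})"
        by (intro bdd_aboveI2[of _ _ "\<bar>A\<bar>"]) auto
      then have "p (\<pi> g (inverse (p v) *\<^sub>R v)) \<le> opnorm p (\<pi> g)"
        unfolding opnorm_def by (rule cSUP_upper[rotated]) (use v in \<open>simp add: sc\<close>)
      also have "\<dots> \<le> rep_bound G p \<pi>"
        unfolding rep_bound_def using g bdd
        by (intro cSUP_upper) (auto simp: uniformly_bounded_def)
      finally show ?thesis
        using v C by (simp add: lin sc field_simps)
    qed
  qed
  have inv: "\<pi> (inv\<^bsub>G\<^esub> g) (\<pi> g v) = v" if g: "g \<in> carrier G" for g v
  proof -
    have "\<pi> (inv\<^bsub>G\<^esub> g \<otimes>\<^bsub>G\<^esub> g) = \<pi> (inv\<^bsub>G\<^esub> g) \<circ> \<pi> g"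
      using hom_mult[OF \<pi>, of "inv\<^bsub>G\<^esub> g" g] g by (simp add: Isom_def)
    moreover have "\<pi> \<one>\<^bsub>G\<^esub> = id"
      using hom_one[OF \<pi> G group_Isom[OF p]] by (simp add: Isom_def)
    ultimately show ?thesis using g by (simp add: fun_eq_iff)
  qed
  show "isometric_rep G p \<pi>"
    unfolding isometric_rep_def using le inv by (metis antisym inv_closed)
qed

text \<open>The span of the vectors \<open>v - \<pi> g v\<close>, and its closure in the semi-norm topology.\<close>

definition cobound :: "('g, 'm) monoid_scheme \<Rightarrow> ('g \<Rightarrow> 'v \<Rightarrow> 'v) \<Rightarrow> 'v::real_vector set" where
  "cobound G \<pi> = span {v - \<pi> g v | v g. g \<in> carrier G}"

definition cobound_closure ::
  "('g, 'm) monoid_scheme \<Rightarrow> ('v \<Rightarrow> real) \<Rightarrow> ('g \<Rightarrow> 'v \<Rightarrow> 'v) \<Rightarrow> 'v::real_vector set" where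
  "cobound_closure G p \<pi> = seminorm_topology p closure_of cobound G \<pi>"


section \<open>Amenability\<close>

definition fin_subsets :: "('g, 'm) monoid_scheme \<Rightarrow> 'g set set" where
  "fin_subsets G = {F. F \<subseteq> carrier G \<and> finite F \<and> F \<noteq> {}}"

definition invariant_sets :: "('g, 'm) monoid_scheme \<Rightarrow> 'g set \<Rightarrow> real \<Rightarrow> 'g set set" where
  "invariant_sets G K \<delta> =
     {F \<in> fin_subsets G. real (card (sym_diff (K <#>\<^bsub>G\<^esub> F) F)) \<le> \<delta> * real (card F)}"

definition amenable :: "('g, 'm) monoid_scheme \<Rightarrow> bool" where
  "amenable G \<longleftrightarrow> (\<forall>K\<in>fin_subsets G. \<forall>\<delta>>0. invariant_sets G K \<delta> \<noteq> {})"

text \<open>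
  The upper limit of \<open>\<rho> F\<close> along \<open>F \<rightarrow> G\<close>. Infimum and supremum are taken in the reals, so this
  is meant for bounded \<open>\<rho>\<close> on an amenable group, where all sets involved are non-empty and bounded.
\<close>

definition limsup_inv :: "('g, 'm) monoid_scheme \<Rightarrow> ('g set \<Rightarrow> real) \<Rightarrow> real" where
  "limsup_inv G \<rho> =
     (INF (K, \<delta>)\<in>fin_subsets G \<times> {0<..}. SUP F\<in>invariant_sets G K \<delta>. \<rho> F)"


section \<open>Set maps\<close>

instantiation "fun" :: (type, real_vector) real_vector
begin

definition scaleR_fun :: "real \<Rightarrow> ('a \<Rightarrow> 'b) \<Rightarrow> 'a \<Rightarrow> 'b" where
  "scaleR_fun c f = (\<lambda>x. c *\<^sub>R f x)"

instance
  by standard (auto simp: scaleR_fun_def fun_eq_iff scaleR_add_right scaleR_add_left)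

end

text \<open>
  A function on the non-empty finite subsets of \<open>G\<close> is represented by the function on all sets that
  extends it by \<open>0\<close>.
\<close>

definition set_maps ::
  "('g, 'm) monoid_scheme \<Rightarrow> ('v::real_vector \<Rightarrow> real) \<Rightarrow> ('g \<Rightarrow> 'v \<Rightarrow> 'v) \<Rightarrow> ('g set \<Rightarrow> 'v) set" where
  "set_maps G p \<pi> =
     {\<phi>. (\<forall>F. F \<notin> fin_subsets G \<longrightarrow> \<phi> F = 0) \<and>
         bdd_above ((\<lambda>F. p (\<phi> F /\<^sub>R real (card F))) ` fin_subsets G) \<and>
         (\<forall>g\<in>carrier G. \<forall>F\<in>fin_subsets G. \<pi> g (\<phi> F) = \<phi> (F #>\<^bsub>G\<^esub> inv\<^bsub>G\<^esub> g))}"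

definition additive_set_maps ::
  "('g, 'm) monoid_scheme \<Rightarrow> ('v::real_vector \<Rightarrow> real) \<Rightarrow> ('g \<Rightarrow> 'v \<Rightarrow> 'v) \<Rightarrow> ('g set \<Rightarrow> 'v) set" where
  "additive_set_maps G p \<pi> =
     {\<phi> \<in> set_maps G p \<pi>.
        \<forall>E\<in>fin_subsets G. \<forall>F\<in>fin_subsets G. E \<inter> F = {} \<longrightarrow> \<phi> (E \<union> F) = \<phi> E + \<phi> F}"

definition set_map_seminorm ::
  "('g, 'm) monoid_scheme \<Rightarrow> ('v::real_vector \<Rightarrow> real) \<Rightarrow> ('g set \<Rightarrow> 'v) \<Rightarrow> real" where
  "set_map_seminorm G p \<phi> = limsup_inv G (\<lambda>F. p (\<phi> F /\<^sub>R real (card F)))"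

definition null_set_maps ::
  "('g, 'm) monoid_scheme \<Rightarrow> ('v::real_vector \<Rightarrow> real) \<Rightarrow> ('g \<Rightarrow> 'v \<Rightarrow> 'v) \<Rightarrow> ('g set \<Rightarrow> 'v) set" where
  "null_set_maps G p \<pi> = {\<phi> \<in> set_maps G p \<pi>. set_map_seminorm G p \<phi> = 0}"

text \<open>
  The norm of a coset of null set maps is the common value of the semi-norm at its elements.
\<close>

definition set_map_norm ::
  "('g, 'm) monoid_scheme \<Rightarrow> ('v::real_vector \<Rightarrow> real) \<Rightarrow> ('g set \<Rightarrow> 'v) set \<Rightarrow> real" where
  "set_map_norm G p \<Phi> = the_elem (set_map_seminorm G p ` \<Phi>)"

definition orbit_sum ::
  "('g, 'm) monoid_scheme \<Rightarrow> ('g \<Rightarrow> 'v \<Rightarrow> 'v) \<Rightarrow> 'v \<Rightarrow> 'g set \<Rightarrow> 'v::real_vector" where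
  "orbit_sum G \<pi> v F = (if F \<in> fin_subsets G then \<Sum>g\<in>F. \<pi> (inv\<^bsub>G\<^esub> g) v else 0)"

text \<open>
  The map sending \<open>v +o U\<close> to \<open>orbit_sum G \<pi> v +o null_set_maps G p \<pi>\<close>, provided that this coset
  does not depend on the choice of \<open>v\<close>.
\<close>

definition orbit_sum_quotient ::
  "('g, 'm) monoid_scheme \<Rightarrow> ('v::real_vector \<Rightarrow> real) \<Rightarrow> ('g \<Rightarrow> 'v \<Rightarrow> 'v) \<Rightarrow> 'v set \<Rightarrow> ('g set \<Rightarrow> 'v) set"
  where
  "orbit_sum_quotient G p \<pi> A =
     the_elem ((\<lambda>v. orbit_sum G \<pi> v +o null_set_maps G p \<pi>) ` A)"

end

theory Submission
  imports Defs
begin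

text \<open>
  Write \<open>A\<^sub>F v\<close> for the average \<open>S(v)(F) / |F|\<close> of the vectors \<open>\<pi>(h\<inverse>) v\<close> over \<open>h \<in> F\<close>, and let
  \<open>C\<close> satisfy \<open>p (\<pi> g v) \<le> C * p v\<close> for all \<open>g\<close> and \<open>v\<close>. Everything follows from comparing the
  asymptotic semi-norm of \<open>S v\<close> with the distance of \<open>v\<close> from the space \<open>L\<close> of coboundaries:
  \<open>dist(v, L) \<le> |||S v||| \<le> C * dist(v, L)\<close>.

  The lower bound is purely algebraic: \<open>v - A\<^sub>F v\<close> is the average of the coboundaries
  \<open>v - \<pi>(h\<inverse>) v\<close>, so \<open>A\<^sub>F v\<close> lies in \<open>v + L\<close> for every \<open>F\<close> (\<open>quotient_seminorm_le_orbit_sum\<close>).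
  The upper bound combines \<open>p (A\<^sub>F v) \<le> C * p v\<close> with the fact that \<open>S\<close> annihilates \<open>L\<close>
  asymptotically: for \<open>v - \<pi> g v\<close> the sum over \<open>F\<close> collapses to sums over \<open>F - g\<inverse>F\<close> and
  \<open>g\<inverse>F - F\<close>, which are small relative to \<open>F\<close> once \<open>F\<close> is sufficiently invariant
  (\<open>orbit_sum_coboundary\<close>). By continuity \<open>S\<close> then annihilates the closure of \<open>L\<close> as well, hence
  it is well defined modulo any \<open>U\<close> in that closure, and the bound passes to the quotient.

  Surjectivity holds even before dividing by the null set maps: an additive equivariant map \<open>\<psi>\<close> is
  determined by \<open>\<psi> {1}\<close>, because \<open>\<psi> {g} = \<pi>(g\<inverse>) (\<psi> {1})\<close>, and so \<open>\<psi> = S (\<psi> {1})\<close>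
  (\<open>additive_set_map_eq_orbit_sum\<close>). If \<open>U\<close> is the whole closure, the lower bound gives
  injectivity and the continuity of the inverse; if \<open>\<pi>\<close> is isometric, then \<open>C = 1\<close> is allowed and
  the two bounds coincide.
\<close>

section \<open>Limits along invariant sets\<close>

lemma fin_subsetsD:
  assumes "F \<in> fin_subsets G"
  shows "F \<subseteq> carrier G" "finite F" "F \<noteq> {}" "card F > 0"
  using assms by (auto simp: fin_subsets_def card_gt_0_iff)

lemma (in group) fin_subsets_nonempty: "fin_subsets G \<noteq> {}"
  by (auto simp: fin_subsets_def intro!: exI[of _ "{\<one>}"])

lemma (in group) card_le_card_set_mult:
  assumes "K \<in> fin_subsets G" "F \<in> fin_subsets G"
  shows "finite (K <#> F)" "card F \<le> card (K <#> F)"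
proof -
  note K = fin_subsetsD[OF assms(1)] and F = fin_subsetsD[OF assms(2)]
  have "K <#> F = (\<lambda>(k, h). k \<otimes> h) ` (K \<times> F)"
    by (auto simp: set_mult_def)
  then show fin: "finite (K <#> F)"
    using K F by simp
  obtain k where k: "k \<in> K" using K by blast
  have "inj_on (\<lambda>h. k \<otimes> h) F"
    using k K F inj_on_cmult inj_on_subset by blast
  then have "card F = card ((\<lambda>h. k \<otimes> h) ` F)"
    by (simp add: card_image)
  also have "\<dots> \<le> card (K <#> F)"
    using k by (intro card_mono fin) (auto simp: set_mult_def)
  finally show "card F \<le> card (K <#> F)" .
qed

text \<open>
  Shrinking \<open>K\<close> can only enlarge \<open>F - KF\<close>, so \<open>(K, \<delta>)\<close>-invariance is not literally monotone in
  \<open>K\<close>. But \<open>|F - KF| \<le> |KF - F|\<close> because \<open>|F| \<le> |KF|\<close>, and \<open>KF - F\<close> is monotone in \<open>K\<close>; this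
  costs the factor 2.
\<close>

lemma (in group) invariant_sets_mono:
  assumes K: "K \<in> fin_subsets G" and K': "K' \<in> fin_subsets G"
    and sub: "K \<subseteq> K'" and d: "\<delta>' \<le> \<delta> / 2"
  shows "invariant_sets G K' \<delta>' \<subseteq> invariant_sets G K \<delta>"
proof
  fix F assume "F \<in> invariant_sets G K' \<delta>'"
  then have F: "F \<in> fin_subsets G"
    and inv: "real (card (sym_diff (K' <#> F) F)) \<le> \<delta>' * real (card F)"
    by (auto simp: invariant_sets_def)
  note fF = fin_subsetsD[OF F]
  note cK = card_le_card_set_mult[OF K F] and cK' = card_le_card_set_mult[OF K' F]
  have "card (F - (K <#> F)) \<le> card ((K <#> F) - F)"
    using cK fF by (simp add: card_le_sym_Diff)
  moreover have "card (sym_diff (K <#> F) F) \<le> card ((K <#> F) - F) + card (F - (K <#> F))"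
    by (rule card_Un_le)
  moreover have "card ((K <#> F) - F) \<le> card (sym_diff (K' <#> F) F)"
    using sub cK' fF by (intro card_mono) (auto simp: set_mult_def)
  ultimately have "real (card (sym_diff (K <#> F) F)) \<le> 2 * real (card (sym_diff (K' <#> F) F))"
    by linarith
  also have "\<dots> \<le> 2 * (\<delta>' * real (card F))"
    using inv by simp
  also have "\<dots> \<le> \<delta> * real (card F)"
    using mult_right_mono[OF d, of "real (card F)"] by simp
  finally show "F \<in> invariant_sets G K \<delta>"
    using F by (simp add: invariant_sets_def)
qed

lemma (in group) invariant_sets_refine:
  assumes "K1 \<in> fin_subsets G" "K2 \<in> fin_subsets G" "\<delta>1 > 0" "\<delta>2 > 0"
  obtains K \<delta> where "K \<in> fin_subsets G" "\<delta> > 0"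
    "invariant_sets G K \<delta> \<subseteq> invariant_sets G K1 \<delta>1 \<inter> invariant_sets G K2 \<delta>2"
proof -
  have K: "K1 \<union> K2 \<in> fin_subsets G"
    using assms by (auto simp: fin_subsets_def)
  show thesis
  proof (rule that)
    show "invariant_sets G (K1 \<union> K2) (min \<delta>1 \<delta>2 / 2)
        \<subseteq> invariant_sets G K1 \<delta>1 \<inter> invariant_sets G K2 \<delta>2"
      using assms K by (intro Int_greatest invariant_sets_mono) auto
  qed (use assms K in auto)
qed

locale amenable_group = group +
  assumes amenable: "amenable G"
begin

lemma invariant_sets_nonempty:
  "K \<in> fin_subsets G \<Longrightarrow> \<delta> > 0 \<Longrightarrow> invariant_sets G K \<delta> \<noteq> {}"
  using amenable by (auto simp: amenable_def)

lemma invariant_sets_subset: "invariant_sets G K \<delta> \<subseteq> fin_subsets G"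
  by (auto simp: invariant_sets_def)

lemma SUP_invariant_sets_ge:
  assumes "\<And>F. F \<in> fin_subsets G \<Longrightarrow> c \<le> \<rho> F" "\<And>F. F \<in> fin_subsets G \<Longrightarrow> \<rho> F \<le> (B::real)"
    and "K \<in> fin_subsets G" "\<delta> > 0"
  shows "c \<le> (SUP F\<in>invariant_sets G K \<delta>. \<rho> F)"
proof -
  obtain F where F: "F \<in> invariant_sets G K \<delta>"
    using invariant_sets_nonempty assms by blast
  show ?thesis
    using F assms(1,2) invariant_sets_subset[of K \<delta>]
    by (intro cSUP_upper2[OF _ F] bdd_aboveI2[of _ _ B]) blast+
qed

lemma limsup_inv_ge:
  assumes "\<And>F. F \<in> fin_subsets G \<Longrightarrow> c \<le> \<rho> F" "\<And>F. F \<in> fin_subsets G \<Longrightarrow> \<rho> F \<le> (B::real)"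
  shows "c \<le> limsup_inv G \<rho>"
  unfolding limsup_inv_def
  using fin_subsets_nonempty gt_ex SUP_invariant_sets_ge[OF assms]
  by (intro cINF_greatest) auto

text \<open>
  The suprema and the infimum in the upper limit are taken in the reals. Since \<open>\<rho>\<close> is bounded and
  the sets of invariant sets are non-empty by amenability, none of them takes a default value, and
  the upper limit has the usual \<open>\<epsilon>\<close>-criterion.
\<close>

lemma limsup_inv_le_iff:
  assumes lo: "\<And>F. F \<in> fin_subsets G \<Longrightarrow> 0 \<le> \<rho> F"
    and hi: "\<And>F. F \<in> fin_subsets G \<Longrightarrow> \<rho> F \<le> (B::real)"
  shows "limsup_inv G \<rho> \<le> c \<longleftrightarrow>
    (\<forall>e>0. \<exists>K\<in>fin_subsets G. \<exists>\<delta>>0. \<forall>F\<in>invariant_sets G K \<delta>. \<rho> F \<le> c + e)"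
proof -
  let ?I = "fin_subsets G \<times> {0::real<..}"
  let ?s = "\<lambda>(K, \<delta>). SUP F\<in>invariant_sets G K \<delta>. \<rho> F"
  have ne: "?I \<noteq> {}"
    using fin_subsets_nonempty gt_ex by auto
  have below: "bdd_below (?s ` ?I)"
    using SUP_invariant_sets_ge[OF lo hi] by (intro bdd_belowI2[of _ 0]) auto
  have above: "bdd_above (\<rho> ` invariant_sets G K \<delta>)" for K \<delta>
    using hi invariant_sets_subset by (intro bdd_aboveI2[of _ _ B]) auto
  show ?thesis
  proof (intro iffI allI impI)
    fix e :: real assume "limsup_inv G \<rho> \<le> c" "e > 0"
    then have "(INF i\<in>?I. ?s i) < c + e"
      by (simp add: limsup_inv_def)
    then obtain K \<delta> where K: "K \<in> fin_subsets G" "\<delta> > 0"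
      and "(SUP F\<in>invariant_sets G K \<delta>. \<rho> F) < c + e"
      by (subst (asm) cINF_less_iff[OF ne below]) auto
    then have "\<forall>F\<in>invariant_sets G K \<delta>. \<rho> F \<le> c + e"
      using cSUP_upper[OF _ above[of K \<delta>]] by fastforce
    with K show "\<exists>K\<in>fin_subsets G. \<exists>\<delta>>0. \<forall>F\<in>invariant_sets G K \<delta>. \<rho> F \<le> c + e"
      by blast
  next
    assume R: "\<forall>e>0. \<exists>K\<in>fin_subsets G. \<exists>\<delta>>0. \<forall>F\<in>invariant_sets G K \<delta>. \<rho> F \<le> c + e"
    show "limsup_inv G \<rho> \<le> c"
    proof (rule field_le_epsilon)
      fix e :: real assume "e > 0"
      with R obtain K \<delta> where K: "K \<in> fin_subsets G" "\<delta> > 0"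
        and le: "\<And>F. F \<in> invariant_sets G K \<delta> \<Longrightarrow> \<rho> F \<le> c + e"
        by blast
      have "limsup_inv G \<rho> \<le> ?s (K, \<delta>)"
        unfolding limsup_inv_def using K by (intro cINF_lower below) auto
      also have "\<dots> \<le> c + e"
        using invariant_sets_nonempty[OF K] le by (auto intro: cSUP_least)
      finally show "limsup_inv G \<rho> \<le> c + e" .
    qed
  qed
qed

end

section \<open>Semi-norms, their topologies and quotients\<close>

lemma seminorm_rules:
  assumes "is_seminorm p"
  shows "p (x + y) \<le> p x + p y" "p (c *\<^sub>R x) = \<bar>c\<bar> * p x" "p 0 = 0" "p (- x) = p x"
    "p (x - y) \<le> p x + p y" "p (x - y) = p (y - x)"
proof -
  show tri: "p (x + y) \<le> p x + p y" for x y
    using assms by (simp add: is_seminorm_def)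
  show sc: "p (c *\<^sub>R x) = \<bar>c\<bar> * p x" for c x
    using assms by (simp add: is_seminorm_def)
  show "p 0 = 0" using sc[of 0 0] by simp
  show neg: "p (- x) = p x" for x using sc[of "-1" x] by simp
  show "p (x - y) \<le> p x + p y" using tri[of x "- y"] neg by simp
  show "p (x - y) = p (y - x)" using neg[of "x - y"] by simp
qed

lemma seminorm_sum_le:
  assumes "is_seminorm p" "finite A" "\<And>a. a \<in> A \<Longrightarrow> p (f a) \<le> B"
  shows "p (sum f A) \<le> real (card A) * B"
  using assms(2,3)
proof (induction A rule: finite_induct)
  case empty
  then show ?case using seminorm_rules(3)[OF assms(1)] by simp
next
  case (insert a A)
  have "p (sum f (insert a A)) \<le> p (f a) + p (sum f A)"
    using insert.hyps seminorm_rules(1)[OF assms(1)] by simp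
  also have "\<dots> \<le> B + real (card A) * B"
    using insert by (intro add_mono) auto
  finally show ?case
    using insert.hyps by (simp add: algebra_simps)
qed

lemma topspace_pseudodist_topology: "topspace (pseudodist_topology X d) = X"
proof -
  have "openin (pseudodist_topology X d) X"
    by (auto simp: openin_pseudodist_topology intro: exI[of _ 1])
  then show ?thesis
    using openin_subset openin_topspace[of "pseudodist_topology X d"]
    by (metis openin_pseudodist_topology subset_antisym)
qed

lemma seminorm_topology_closure_of:
  assumes p: "is_seminorm p"
  shows "seminorm_topology p closure_of L = {v. \<forall>e>0. \<exists>l\<in>L. p (v - l) < e}"
proof -
  have ball: "openin (seminorm_topology p) {w. p (v - w) < e}" for v and e :: real
    unfolding openin_pseudodist_topology
  proof (intro conjI ballI)
    fix x assume x: "x \<in> {w. p (v - w) < e}"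
    have "p (v - y) < e" if "p (x - y) < e - p (v - x)" for y
      using seminorm_rules(1)[OF p, of "v - x" "x - y"] that by simp
    with x show "\<exists>e'>0. \<forall>y\<in>UNIV. p (x - y) < e' \<longrightarrow> y \<in> {w. p (v - w) < e}"
      by (intro exI[of _ "e - p (v - x)"]) auto
  qed simp
  show ?thesis
  proof (intro subset_antisym subsetI)
    fix v assume v: "v \<in> seminorm_topology p closure_of L"
    have "\<exists>l\<in>L. p (v - l) < e" if "e > 0" for e
    proof -
      have "v \<in> {w. p (v - w) < e}"
        using that seminorm_rules(3)[OF p] by simp
      with ball[of v e] have "\<exists>l. l \<in> L \<and> l \<in> {w. p (v - w) < e}"
        using v[unfolded in_closure_of, THEN conjunct2, rule_format, of "{w. p (v - w) < e}"]
        by simp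
      then show ?thesis by blast
    qed
    then show "v \<in> {v. \<forall>e>0. \<exists>l\<in>L. p (v - l) < e}" by simp
  next
    fix v assume v: "v \<in> {v. \<forall>e>0. \<exists>l\<in>L. p (v - l) < e}"
    show "v \<in> seminorm_topology p closure_of L"
      unfolding in_closure_of topspace_pseudodist_topology
    proof (intro conjI allI impI UNIV_I)
      fix T assume "v \<in> T \<and> openin (seminorm_topology p) T"
      then obtain e where "e > 0" "\<forall>y. p (v - y) < e \<longrightarrow> y \<in> T"
        by (auto simp: openin_pseudodist_topology)
      with v show "\<exists>y. y \<in> L \<and> y \<in> T" by blast
    qed
  qed
qed

lemma continuous_map_pseudodist_topology:
  assumes maps: "f ` X \<subseteq> Y" and B: "B > 0"
    and lip: "\<And>x y. x \<in> X \<Longrightarrow> y \<in> X \<Longrightarrow> d' (f x) (f y) \<le> B * d x y"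
  shows "continuous_map (pseudodist_topology X d) (pseudodist_topology Y d') f"
  unfolding continuous_map_def topspace_pseudodist_topology
proof (intro conjI allI impI)
  show "f \<in> X \<rightarrow> Y" using maps by auto
  fix W assume W: "openin (pseudodist_topology Y d') W"
  show "openin (pseudodist_topology X d) {x \<in> X. f x \<in> W}"
    unfolding openin_pseudodist_topology
  proof (intro conjI ballI)
    fix x assume "x \<in> {x \<in> X. f x \<in> W}"
    then have x: "x \<in> X" and "f x \<in> W" by auto
    then obtain e where e: "e > 0" "\<And>y. y \<in> Y \<Longrightarrow> d' (f x) y < e \<Longrightarrow> y \<in> W"
      using W by (auto simp: openin_pseudodist_topology)
    have "f y \<in> W" if "y \<in> X" "d x y < e / B" for y
    proof (rule e(2))
      have "d' (f x) (f y) \<le> B * d x y" using lip x that by blast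
      also have "\<dots> < e" using that B by (simp add: field_simps)
      finally show "d' (f x) (f y) < e" .
    qed (use maps that in auto)
    then show "\<exists>e>0. \<forall>y\<in>X. d x y < e \<longrightarrow> y \<in> {x \<in> X. f x \<in> W}"
      using e(1) B by (intro exI[of _ "e / B"]) auto
  qed auto
qed

lemma image_eq_singleton:
  assumes "a \<in> A" "\<And>x. x \<in> A \<Longrightarrow> f x = c"
  shows "f ` A = {c}"
  using assms by auto

lemma mem_elt_set_plus_iff: "w \<in> v +o U \<longleftrightarrow> w - v \<in> U" for v w :: "'v::real_vector"
  by (auto simp: elt_set_plus_def) (metis add.commute diff_add_cancel)

lemma coset_eq_iff:
  fixes v w :: "'v::real_vector"
  assumes "subspace U"
  shows "v +o U = w +o U \<longleftrightarrow> v - w \<in> U"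
proof
  assume "v +o U = w +o U"
  moreover have "v \<in> v +o U" using subspace_0[OF assms] by (simp add: mem_elt_set_plus_iff)
  ultimately show "v - w \<in> U" by (simp add: mem_elt_set_plus_iff)
next
  assume d: "v - w \<in> U"
  have "x - v \<in> U \<longleftrightarrow> x - w \<in> U" for x
    using subspace_add[OF assms _ d, of "x - v"] subspace_diff[OF assms _ d, of "x - w"] by auto
  then show "v +o U = w +o U" by (auto simp: mem_elt_set_plus_iff)
qed

lemma quotient_seminorm_le:
  assumes "is_seminorm p" "u \<in> v +o U"
  shows "quotient_seminorm p (v +o U) \<le> p u"
  unfolding quotient_seminorm_def
  using assms by (intro cINF_lower bdd_belowI2[of _ 0]) (auto intro: seminorm_nonneg)

section \<open>The space of set maps\<close>

text \<open>
  The constant \<open>C\<close> is a parameter rather than the least bound of \<open>\<pi>\<close>, so that \<open>C = 1\<close> can be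
  used for an isometric representation even if \<open>p\<close> vanishes identically.
\<close>

locale amenable_rep = amenable_group G for G :: "('g, 'm) monoid_scheme" (structure) +
  fixes p :: "'v::real_vector \<Rightarrow> real" and \<pi> :: "'g \<Rightarrow> 'v \<Rightarrow> 'v" and C :: real
  assumes p: "is_seminorm p"
    and rep: "\<pi> \<in> hom G (Isom p)"
    and bound: "\<And>g v. g \<in> carrier G \<Longrightarrow> p (\<pi> g v) \<le> C * p v"
    and C_pos: "C > 0"
begin

lemma rep_linear: "g \<in> carrier G \<Longrightarrow> linear (\<pi> g)"
  using rep by (auto simp: hom_def Isom_def bounded_operator_def)

lemma rep_mult: "g \<in> carrier G \<Longrightarrow> h \<in> carrier G \<Longrightarrow> \<pi> (g \<otimes> h) v = \<pi> g (\<pi> h v)"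
  using hom_mult[OF rep] by (simp add: Isom_def)

lemma rep_one: "\<pi> \<one> v = v"
  using hom_one[OF rep group_axioms group_Isom[OF p]] by (simp add: Isom_def)

abbreviation "M \<equiv> set_maps G p \<pi>"
abbreviation "N \<equiv> null_set_maps G p \<pi>"
abbreviation "nrm \<equiv> set_map_seminorm G p"

lemma set_maps_bound:
  assumes "\<phi> \<in> M"
  obtains B where "\<And>F. F \<in> fin_subsets G \<Longrightarrow> p (\<phi> F /\<^sub>R real (card F)) \<le> B"
proof -
  have "bdd_above ((\<lambda>F. p (\<phi> F /\<^sub>R real (card F))) ` fin_subsets G)"
    using assms by (simp add: set_maps_def)
  then show thesis using that by (meson bdd_above.E imageI)
qed

lemma set_map_seminorm_le_iff:
  assumes "\<phi> \<in> M"
  shows "nrm \<phi> \<le> c \<longleftrightarrow>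
    (\<forall>e>0. \<exists>K\<in>fin_subsets G. \<exists>\<delta>>0. \<forall>F\<in>invariant_sets G K \<delta>. p (\<phi> F /\<^sub>R real (card F)) \<le> c + e)"
proof -
  obtain B where "\<And>F. F \<in> fin_subsets G \<Longrightarrow> p (\<phi> F /\<^sub>R real (card F)) \<le> B"
    using set_maps_bound[OF assms] by blast
  then show ?thesis
    unfolding set_map_seminorm_def by (intro limsup_inv_le_iff) (auto intro: seminorm_nonneg[OF p])
qed

lemma set_map_seminorm_ge:
  assumes "\<phi> \<in> M" "\<And>F. F \<in> fin_subsets G \<Longrightarrow> c \<le> p (\<phi> F /\<^sub>R real (card F))"
  shows "c \<le> nrm \<phi>"
proof -
  obtain B where "\<And>F. F \<in> fin_subsets G \<Longrightarrow> p (\<phi> F /\<^sub>R real (card F)) \<le> B"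
    using set_maps_bound[OF assms(1)] by blast
  then show ?thesis
    unfolding set_map_seminorm_def using assms(2) by (intro limsup_inv_ge) auto
qed

lemma set_map_seminorm_nonneg: "\<phi> \<in> M \<Longrightarrow> 0 \<le> nrm \<phi>"
  by (rule set_map_seminorm_ge) (auto intro: seminorm_nonneg[OF p])

lemma r_coset_fin_subsets:
  assumes "F \<in> fin_subsets G" "g \<in> carrier G"
  shows "F #> g \<in> fin_subsets G"
  using assms by (auto simp: fin_subsets_def r_coset_def)

lemma subspace_set_maps: "subspace M"
proof (rule subspaceI)
  show "0 \<in> M"
    using linear_0[OF rep_linear] by (auto simp: set_maps_def seminorm_rules(3)[OF p])
next
  fix \<phi> \<psi> assume \<phi>: "\<phi> \<in> M" and \<psi>: "\<psi> \<in> M"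
  obtain A where A: "\<And>F. F \<in> fin_subsets G \<Longrightarrow> p (\<phi> F /\<^sub>R real (card F)) \<le> A"
    using set_maps_bound[OF \<phi>] by blast
  obtain B where B: "\<And>F. F \<in> fin_subsets G \<Longrightarrow> p (\<psi> F /\<^sub>R real (card F)) \<le> B"
    using set_maps_bound[OF \<psi>] by blast
  have "p ((\<phi> + \<psi>) F /\<^sub>R real (card F)) \<le> A + B" if F: "F \<in> fin_subsets G" for F
    using seminorm_rules(1)[OF p, of "\<phi> F /\<^sub>R real (card F)" "\<psi> F /\<^sub>R real (card F)"] A[OF F] B[OF F]
    by (simp add: scaleR_add_right)
  then show "\<phi> + \<psi> \<in> M"
    using \<phi> \<psi> linear_add[OF rep_linear] by (auto simp: set_maps_def intro!: bdd_aboveI2)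
next
  fix c \<phi> assume \<phi>: "\<phi> \<in> M"
  obtain A where A: "\<And>F. F \<in> fin_subsets G \<Longrightarrow> p (\<phi> F /\<^sub>R real (card F)) \<le> A"
    using set_maps_bound[OF \<phi>] by blast
  have "p ((c *\<^sub>R \<phi>) F /\<^sub>R real (card F)) \<le> \<bar>c\<bar> * A" if F: "F \<in> fin_subsets G" for F
    using mult_left_mono[OF A[OF F], of "\<bar>c\<bar>"] seminorm_rules(2)[OF p, of c "\<phi> F /\<^sub>R real (card F)"]
    by (simp add: scaleR_fun_def mult.commute)
  then show "c *\<^sub>R \<phi> \<in> M"
    using \<phi> linear_scale[OF rep_linear]
    by (auto simp: set_maps_def scaleR_fun_def intro!: bdd_aboveI2)
qed

lemma set_map_seminorm_add:
  assumes \<phi>: "\<phi> \<in> M" and \<psi>: "\<psi> \<in> M"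
  shows "nrm (\<phi> + \<psi>) \<le> nrm \<phi> + nrm \<psi>"
  unfolding set_map_seminorm_le_iff[OF subspace_add[OF subspace_set_maps \<phi> \<psi>]]
proof (intro allI impI)
  fix e :: real assume e: "e > 0"
  then have e2: "e / 2 > 0" by simp
  obtain K1 d1 where 1: "K1 \<in> fin_subsets G" "d1 > 0"
    "\<forall>F\<in>invariant_sets G K1 d1. p (\<phi> F /\<^sub>R real (card F)) \<le> nrm \<phi> + e / 2"
    using set_map_seminorm_le_iff[OF \<phi>, of "nrm \<phi>"] e2 by blast
  obtain K2 d2 where 2: "K2 \<in> fin_subsets G" "d2 > 0"
    "\<forall>F\<in>invariant_sets G K2 d2. p (\<psi> F /\<^sub>R real (card F)) \<le> nrm \<psi> + e / 2"
    using set_map_seminorm_le_iff[OF \<psi>, of "nrm \<psi>"] e2 by blast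
  obtain K d where K: "K \<in> fin_subsets G" "d > 0"
    and sub: "invariant_sets G K d \<subseteq> invariant_sets G K1 d1 \<inter> invariant_sets G K2 d2"
    using invariant_sets_refine[OF 1(1) 2(1) 1(2) 2(2)] by blast
  have "p ((\<phi> + \<psi>) F /\<^sub>R real (card F)) \<le> nrm \<phi> + nrm \<psi> + e" if F: "F \<in> invariant_sets G K d" for F
  proof -
    have "p (\<phi> F /\<^sub>R real (card F)) \<le> nrm \<phi> + e / 2" "p (\<psi> F /\<^sub>R real (card F)) \<le> nrm \<psi> + e / 2"
      using F sub 1(3) 2(3) by auto
    then show ?thesis
      using seminorm_rules(1)[OF p, of "\<phi> F /\<^sub>R real (card F)" "\<psi> F /\<^sub>R real (card F)"]
      by (simp add: scaleR_add_right)
  qed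
  with K show "\<exists>K\<in>fin_subsets G. \<exists>\<delta>>0. \<forall>F\<in>invariant_sets G K \<delta>.
      p ((\<phi> + \<psi>) F /\<^sub>R real (card F)) \<le> nrm \<phi> + nrm \<psi> + e"
    by blast
qed

lemma set_map_seminorm_zero: "nrm 0 = 0"
proof -
  have "nrm 0 \<le> 0"
    unfolding set_map_seminorm_le_iff[OF subspace_0[OF subspace_set_maps]]
    using fin_subsets_nonempty by (force simp: seminorm_rules(3)[OF p] intro: exI[of _ 1])
  then show ?thesis
    using set_map_seminorm_nonneg[OF subspace_0[OF subspace_set_maps]] by simp
qed

lemma set_map_seminorm_scale_le:
  assumes \<phi>: "\<phi> \<in> M"
  shows "nrm (c *\<^sub>R \<phi>) \<le> \<bar>c\<bar> * nrm \<phi>"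
proof (cases "c = 0")
  case True
  then show ?thesis by (simp add: set_map_seminorm_zero)
next
  case False
  show ?thesis
    unfolding set_map_seminorm_le_iff[OF subspace_scale[OF subspace_set_maps \<phi>]]
  proof (intro allI impI)
    fix e :: real assume "e > 0"
    then have "e / \<bar>c\<bar> > 0" using False by simp
    then obtain K d where K: "K \<in> fin_subsets G" "d > 0"
      "\<forall>F\<in>invariant_sets G K d. p (\<phi> F /\<^sub>R real (card F)) \<le> nrm \<phi> + e / \<bar>c\<bar>"
      using set_map_seminorm_le_iff[OF \<phi>, of "nrm \<phi>"] by blast
    have "p ((c *\<^sub>R \<phi>) F /\<^sub>R real (card F)) \<le> \<bar>c\<bar> * nrm \<phi> + e" if F: "F \<in> invariant_sets G K d" for F
    proof -
      have "p ((c *\<^sub>R \<phi>) F /\<^sub>R real (card F)) = \<bar>c\<bar> * p (\<phi> F /\<^sub>R real (card F))"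
        using seminorm_rules(2)[OF p, of c "\<phi> F /\<^sub>R real (card F)"]
        by (simp add: scaleR_fun_def mult.commute)
      also have "\<dots> \<le> \<bar>c\<bar> * (nrm \<phi> + e / \<bar>c\<bar>)"
        using K(3) F by (intro mult_left_mono) auto
      also have "\<dots> = \<bar>c\<bar> * nrm \<phi> + e"
        using False by (simp add: distrib_left)
      finally show ?thesis .
    qed
    with K show "\<exists>K\<in>fin_subsets G. \<exists>\<delta>>0. \<forall>F\<in>invariant_sets G K \<delta>.
        p ((c *\<^sub>R \<phi>) F /\<^sub>R real (card F)) \<le> \<bar>c\<bar> * nrm \<phi> + e"
      by blast
  qed
qed

lemma subspace_null_set_maps: "subspace N"
proof (rule subspaceI)
  show "0 \<in> N"
    by (simp add: null_set_maps_def set_map_seminorm_zero subspace_0[OF subspace_set_maps])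
  show "\<phi> + \<psi> \<in> N" if "\<phi> \<in> N" "\<psi> \<in> N" for \<phi> \<psi>
    using that set_map_seminorm_add[of \<phi> \<psi>] set_map_seminorm_nonneg[of "\<phi> + \<psi>"]
      subspace_add[OF subspace_set_maps, of \<phi> \<psi>]
    by (simp add: null_set_maps_def)
  show "c *\<^sub>R \<phi> \<in> N" if "\<phi> \<in> N" for c \<phi>
    using that set_map_seminorm_scale_le[of \<phi> c] set_map_seminorm_nonneg[of "c *\<^sub>R \<phi>"]
      subspace_scale[OF subspace_set_maps, of \<phi> c]
    by (simp add: null_set_maps_def)
qed

lemma set_map_norm_coset:
  assumes \<phi>: "\<phi> \<in> M"
  shows "set_map_norm G p (\<phi> +o N) = nrm \<phi>"
proof -
  have le: "nrm \<psi> \<le> nrm \<phi>" if "\<phi> \<in> M" "\<psi> - \<phi> \<in> N" for \<phi> \<psi>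
    using set_map_seminorm_add[of \<phi> "\<psi> - \<phi>"] that by (simp add: null_set_maps_def)
  have const: "nrm \<psi> = nrm \<phi>" if "\<psi> \<in> \<phi> +o N" for \<psi>
  proof (rule antisym)
    have d: "\<psi> - \<phi> \<in> N" using that by (simp add: mem_elt_set_plus_iff)
    then show "nrm \<psi> \<le> nrm \<phi>" using le \<phi> by blast
    have "\<phi> + (\<psi> - \<phi>) \<in> M"
      using \<phi> d by (intro subspace_add subspace_set_maps) (simp_all add: null_set_maps_def)
    moreover have "\<phi> - \<psi> \<in> N"
      using subspace_neg[OF subspace_null_set_maps d] by simp
    ultimately show "nrm \<phi> \<le> nrm \<psi>" using le by simp
  qed
  have "\<phi> \<in> \<phi> +o N"
    using subspace_0[OF subspace_null_set_maps] by (simp add: mem_elt_set_plus_iff)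
  then have "nrm ` (\<phi> +o N) = {nrm \<phi>}"
    by (rule image_eq_singleton) (rule const)
  then show ?thesis by (simp add: set_map_norm_def)
qed

section \<open>Orbit sums\<close>

abbreviation "S \<equiv> orbit_sum G \<pi>"

lemma rep_inv_linear: "F \<in> fin_subsets G \<Longrightarrow> h \<in> F \<Longrightarrow> linear (\<pi> (inv h))"
  by (intro rep_linear inv_closed) (auto dest: fin_subsetsD)

lemma linear_orbit_sum: "linear S"
proof (rule linearI)
  show "S (v + w) = S v + S w" for v w
    by (rule ext) (simp add: orbit_sum_def sum.distrib linear_add[OF rep_inv_linear]
        cong: sum.cong)
  show "S (c *\<^sub>R v) = c *\<^sub>R S v" for c v
    by (rule ext) (simp add: orbit_sum_def scaleR_fun_def scaleR_sum_right
        linear_scale[OF rep_inv_linear] cong: sum.cong)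
qed

lemma orbit_average_le:
  assumes F: "F \<in> fin_subsets G"
  shows "p (S v F /\<^sub>R real (card F)) \<le> C * p v"
proof -
  have "p (\<Sum>g\<in>F. \<pi> (inv g) v) \<le> real (card F) * (C * p v)"
    using fin_subsetsD[OF F] by (intro seminorm_sum_le p bound inv_closed) auto
  then show ?thesis
    using F fin_subsetsD(4)[OF F]
    by (simp add: orbit_sum_def seminorm_rules(2)[OF p] field_simps)
qed

lemma additive_orbit_sum: "S v \<in> additive_set_maps G p \<pi>"
proof -
  have "\<pi> g (S v F) = S v (F #> inv g)" if g: "g \<in> carrier G" and F: "F \<in> fin_subsets G" for g F
  proof -
    note fF = fin_subsetsD[OF F]
    have inj: "inj_on (\<lambda>h. h \<otimes> inv g) F"
      using fF inj_on_multc[OF inv_closed[OF g]] inj_on_subset by blast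
    have "\<pi> g (S v F) = (\<Sum>h\<in>F. \<pi> g (\<pi> (inv h) v))"
      using F by (simp add: orbit_sum_def linear_sum[OF rep_linear[OF g]])
    also have "\<dots> = (\<Sum>h\<in>F. \<pi> (inv (h \<otimes> inv g)) v)"
      using g fF by (intro sum.cong refl) (auto simp: inv_mult_group rep_mult subset_iff)
    also have "\<dots> = (\<Sum>h\<in>(\<lambda>h. h \<otimes> inv g) ` F. \<pi> (inv h) v)"
      by (simp add: sum.reindex[OF inj])
    also have "(\<lambda>h. h \<otimes> inv g) ` F = F #> inv g"
      by (auto simp: r_coset_def)
    finally show ?thesis
      using r_coset_fin_subsets[OF F inv_closed[OF g]] by (simp add: orbit_sum_def)
  qed
  moreover have "S v F = 0" if "F \<notin> fin_subsets G" for F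
    using that by (simp add: orbit_sum_def)
  moreover have "bdd_above ((\<lambda>F. p (S v F /\<^sub>R real (card F))) ` fin_subsets G)"
    using orbit_average_le by (intro bdd_aboveI2) blast
  ultimately have "S v \<in> M"
    by (simp add: set_maps_def)
  moreover have "S v (E \<union> F) = S v E + S v F"
    if "E \<in> fin_subsets G" "F \<in> fin_subsets G" "E \<inter> F = {}" for E F
  proof -
    have "E \<union> F \<in> fin_subsets G" using that by (auto simp: fin_subsets_def)
    then show ?thesis
      using that fin_subsetsD(2)[OF that(1)] fin_subsetsD(2)[OF that(2)]
      by (simp add: orbit_sum_def sum.union_disjoint)
  qed
  ultimately show ?thesis by (simp add: additive_set_maps_def)
qed

lemma orbit_sum_set_map: "S v \<in> M"
  using additive_orbit_sum by (simp add: additive_set_maps_def)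

lemma orbit_sum_seminorm_le: "nrm (S v) \<le> C * p v"
  unfolding set_map_seminorm_le_iff[OF orbit_sum_set_map]
proof (intro allI impI)
  fix e :: real assume "e > 0"
  obtain K where "K \<in> fin_subsets G" using fin_subsets_nonempty by blast
  moreover have "p (S v F /\<^sub>R real (card F)) \<le> C * p v + e" if "F \<in> invariant_sets G K 1" for F
    using orbit_average_le[of F v] that invariant_sets_subset \<open>e > 0\<close> by fastforce
  ultimately show "\<exists>K\<in>fin_subsets G. \<exists>\<delta>>0. \<forall>F\<in>invariant_sets G K \<delta>.
      p (S v F /\<^sub>R real (card F)) \<le> C * p v + e"
    by (intro bexI[of _ K] exI[of _ 1]) auto
qed

text \<open>
  Equivariance moves the value at \<open>{1}\<close> to every singleton, and additivity sums the singletons.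
\<close>

lemma additive_set_map_eq_orbit_sum:
  assumes \<psi>: "\<psi> \<in> additive_set_maps G p \<pi>"
  shows "\<psi> = S (\<psi> {\<one>})"
proof
  fix F
  have add: "\<psi> (E \<union> F) = \<psi> E + \<psi> F"
    if "E \<in> fin_subsets G" "F \<in> fin_subsets G" "E \<inter> F = {}" for E F
    using \<psi> that by (auto simp: additive_set_maps_def)
  have equi: "\<pi> g (\<psi> F) = \<psi> (F #> inv g)" if "g \<in> carrier G" "F \<in> fin_subsets G" for g F
    using \<psi> that by (auto simp: additive_set_maps_def set_maps_def)
  have single: "\<psi> {g} = \<pi> (inv g) (\<psi> {\<one>})" if g: "g \<in> carrier G" for g
    using equi[OF inv_closed[OF g], of "{\<one>}"] g by (simp add: fin_subsets_def r_coset_def)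
  show "\<psi> F = S (\<psi> {\<one>}) F"
  proof (cases "F \<in> fin_subsets G")
    case False
    then show ?thesis
      using \<psi> by (simp add: additive_set_maps_def set_maps_def orbit_sum_def)
  next
    case True
    have "finite F" "F \<noteq> {}" "F \<subseteq> carrier G" using fin_subsetsD[OF True] by auto
    then have "\<psi> F = (\<Sum>g\<in>F. \<pi> (inv g) (\<psi> {\<one>}))"
    proof (induction F rule: finite_ne_induct)
      case (singleton x)
      then show ?case using single[of x] by simp
    next
      case (insert x F)
      then have "\<psi> ({x} \<union> F) = \<psi> {x} + \<psi> F"
        by (intro add) (auto simp: fin_subsets_def)
      with insert show ?case by (simp add: single[of x])
    qed
    with True show ?thesis by (simp add: orbit_sum_def)
  qed
qed

section \<open>Orbit sums and coboundaries\<close>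

text \<open>
  The orbit sum of \<open>\<pi> g v\<close> over \<open>F\<close> is the orbit sum of \<open>v\<close> over \<open>g\<inverse>F\<close>. Subtracting the two, the
  common terms cancel and at most \<open>|F \<Delta> g\<inverse>F|\<close> terms of size \<open>C * p v\<close> are left.
\<close>

lemma orbit_sum_coboundary:
  assumes g: "g \<in> carrier G"
  shows "S (v - \<pi> g v) \<in> N"
proof -
  let ?w = "v - \<pi> g v" and ?f = "\<lambda>k. \<pi> (inv k) v"
  have K: "{inv g} \<in> fin_subsets G" using g by (simp add: fin_subsets_def)
  have est: "p (S ?w F /\<^sub>R real (card F)) \<le> \<delta> * (C * p v)"
    if inv: "F \<in> invariant_sets G {inv g} \<delta>" for F \<delta>
  proof -
    have F: "F \<in> fin_subsets G"
      and cF: "real (card (sym_diff ({inv g} <#> F) F)) \<le> \<delta> * real (card F)"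
      using inv by (auto simp: invariant_sets_def)
    note fF = fin_subsetsD[OF F]
    define E where "E = (\<lambda>h. inv g \<otimes> h) ` F"
    have E: "{inv g} <#> F = E" by (auto simp: E_def set_mult_def)
    have finE: "finite E" and Ec: "E \<subseteq> carrier G" using fF g by (auto simp: E_def)
    have inj: "inj_on (\<lambda>h. inv g \<otimes> h) F"
      using fF inj_on_cmult[OF inv_closed[OF g]] inj_on_subset by blast
    have "S (\<pi> g v) F = (\<Sum>h\<in>F. ?f (inv g \<otimes> h))"
      using F fF g by (auto simp: orbit_sum_def inv_mult_group rep_mult subset_iff intro!: sum.cong)
    also have "\<dots> = sum ?f E"
      by (simp add: E_def sum.reindex[OF inj])
    finally have "S ?w F = sum ?f F - sum ?f E"
      using F by (simp add: linear_diff[OF linear_orbit_sum]) (simp add: orbit_sum_def)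
    also have "\<dots> = sum ?f (F - E) - sum ?f (E - F)"
      using sum.Int_Diff[of F ?f E] sum.Int_Diff[of E ?f F] fF finE by (simp add: Int_commute)
    finally have eq: "S ?w F = sum ?f (F - E) - sum ?f (E - F)" .
    have "p (S ?w F) \<le> p (sum ?f (F - E)) + p (sum ?f (E - F))"
      unfolding eq by (rule seminorm_rules(5)[OF p])
    also have "\<dots> \<le> real (card (F - E)) * (C * p v) + real (card (E - F)) * (C * p v)"
      using fF finE Ec by (intro add_mono seminorm_sum_le p bound inv_closed) auto
    also have "\<dots> = real (card (sym_diff E F)) * (C * p v)"
      using fF finE by (subst card_Un_disjoint) (auto simp: algebra_simps)
    also have "\<dots> \<le> \<delta> * real (card F) * (C * p v)"
      using cF E C_pos seminorm_nonneg[OF p, of v] by (intro mult_right_mono) auto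
    finally show ?thesis
      using fF(4) by (simp add: seminorm_rules(2)[OF p] field_simps)
  qed
  have "nrm (S ?w) \<le> 0"
    unfolding set_map_seminorm_le_iff[OF orbit_sum_set_map]
  proof (intro allI impI)
    fix e :: real assume e: "e > 0"
    have nn: "0 \<le> C * p v" using C_pos seminorm_nonneg[OF p] by simp
    \<comment> \<open>Adding 1 keeps the denominator positive when \<open>p v = 0\<close>.\<close>
    define \<delta> where "\<delta> = e / (C * p v + 1)"
    have "\<delta> > 0" "\<delta> * (C * p v) \<le> e"
      using e nn by (simp_all add: \<delta>_def field_simps)
    with K est show "\<exists>K\<in>fin_subsets G. \<exists>\<delta>>0. \<forall>F\<in>invariant_sets G K \<delta>.
        p (S ?w F /\<^sub>R real (card F)) \<le> 0 + e"
      by (intro bexI[of _ "{inv g}"] exI[of _ \<delta>]) (auto intro: order_trans)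
  qed
  then show ?thesis
    using set_map_seminorm_nonneg[OF orbit_sum_set_map, of ?w] orbit_sum_set_map
    by (simp add: null_set_maps_def)
qed

abbreviation "L \<equiv> cobound G \<pi>"
abbreviation "cL \<equiv> cobound_closure G p \<pi>"

lemma cobound_closure_iff: "v \<in> cL \<longleftrightarrow> (\<forall>e>0. \<exists>l\<in>L. p (v - l) < e)"
  by (simp add: cobound_closure_def seminorm_topology_closure_of[OF p])

lemma orbit_sum_cobound: "l \<in> L \<Longrightarrow> S l \<in> N"
proof -
  have "subspace {l. S l \<in> N}"
    using linear_subspace_vimage[OF linear_orbit_sum subspace_null_set_maps] by (simp add: vimage_def)
  then have "L \<subseteq> {l. S l \<in> N}"
    unfolding cobound_def using orbit_sum_coboundary by (intro span_minimal) auto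
  then show "l \<in> L \<Longrightarrow> S l \<in> N" by blast
qed

lemma orbit_sum_cobound_closure:
  assumes "v \<in> cL"
  shows "S v \<in> N"
proof -
  have "nrm (S v) \<le> 0"
  proof (rule field_le_epsilon)
    fix e :: real assume "e > 0"
    then have "e / C > 0" using C_pos by simp
    then obtain l where l: "l \<in> L" "p (v - l) < e / C"
      using assms unfolding cobound_closure_iff by blast
    have "nrm (S v) \<le> nrm (S l) + nrm (S (v - l))"
      using set_map_seminorm_add[OF orbit_sum_set_map orbit_sum_set_map, of l "v - l"]
      by (simp add: linear_diff[OF linear_orbit_sum])
    also have "nrm (S l) = 0"
      using orbit_sum_cobound[OF l(1)] by (simp add: null_set_maps_def)
    also have "nrm (S (v - l)) \<le> C * p (v - l)" by (rule orbit_sum_seminorm_le)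
    also have "\<dots> \<le> e" using l(2) C_pos by (simp add: field_simps)
    finally show "nrm (S v) \<le> 0 + e" by simp
  qed
  then show ?thesis
    using set_map_seminorm_nonneg[OF orbit_sum_set_map, of v] orbit_sum_set_map
    by (simp add: null_set_maps_def)
qed

lemma orbit_sum_seminorm_le_quotient:
  assumes U: "subspace U" "U \<subseteq> cL"
  shows "nrm (S v) \<le> C * quotient_seminorm p (v +o U)"
proof -
  have "nrm (S v) / C \<le> p a" if "a \<in> v +o U" for a
  proof -
    have "a - v \<in> U" using that by (simp add: mem_elt_set_plus_iff)
    then have "v - a \<in> U" using subspace_neg[OF U(1)] by fastforce
    then have "S (v - a) \<in> N" using orbit_sum_cobound_closure U by blast
    then have "nrm (S (v - a)) = 0" by (simp add: null_set_maps_def)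
    then have "nrm (S v) \<le> nrm (S a)"
      using set_map_seminorm_add[OF orbit_sum_set_map orbit_sum_set_map, of a "v - a"]
      by (simp add: linear_diff[OF linear_orbit_sum])
    also have "\<dots> \<le> C * p a" by (rule orbit_sum_seminorm_le)
    finally show ?thesis using C_pos by (simp add: field_simps)
  qed
  moreover have "v +o U \<noteq> {}"
    using subspace_0[OF U(1)] by (auto simp: elt_set_plus_def)
  ultimately have "nrm (S v) / C \<le> quotient_seminorm p (v +o U)"
    unfolding quotient_seminorm_def by (intro cINF_greatest) auto
  then show ?thesis using C_pos by (simp add: field_simps)
qed

text \<open>
  With \<open>A\<^sub>F v = S v F / |F|\<close>, the vector \<open>A\<^sub>F v - v\<close> is an average of coboundaries, so
  \<open>A\<^sub>F v\<close> is itself a competitor in the infimum that defines the quotient semi-norm, whatever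
  \<open>F\<close> is.
\<close>

lemma quotient_seminorm_le_orbit_sum:
  assumes U: "L \<subseteq> U"
  shows "quotient_seminorm p (v +o U) \<le> nrm (S v)"
proof (rule set_map_seminorm_ge[OF orbit_sum_set_map])
  fix F assume F: "F \<in> fin_subsets G"
  note fF = fin_subsetsD[OF F]
  let ?n = "real (card F)"
  have "\<pi> (inv h) v - v \<in> L" if "h \<in> F" for h
  proof -
    have "v - \<pi> (inv h) v \<in> L"
      unfolding cobound_def using that fF by (intro span_base) blast
    then have "- (v - \<pi> (inv h) v) \<in> L"
      unfolding cobound_def by (rule span_neg)
    then show ?thesis by simp
  qed
  then have "(\<Sum>h\<in>F. \<pi> (inv h) v - v) /\<^sub>R ?n \<in> L"
    unfolding cobound_def by (intro span_scale span_sum)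
  moreover have "(\<Sum>h\<in>F. \<pi> (inv h) v - v) /\<^sub>R ?n = S v F /\<^sub>R ?n - v"
    using F fF(4) by (simp add: orbit_sum_def sum_subtractf sum_constant_scaleR scaleR_diff_right)
  ultimately have "S v F /\<^sub>R ?n \<in> v +o U"
    using U by (auto simp: mem_elt_set_plus_iff)
  then show "quotient_seminorm p (v +o U) \<le> p (S v F /\<^sub>R ?n)"
    by (rule quotient_seminorm_le[OF p])
qed

lemma cobound_subset_closure: "L \<subseteq> cL"
proof
  fix v assume "v \<in> L"
  moreover have "p (v - v) = 0" by (simp add: seminorm_rules(3)[OF p])
  ultimately show "v \<in> cL" unfolding cobound_closure_iff by force
qed

text \<open>
  The closure of \<open>L\<close> consists of the vectors at distance 0 from \<open>L\<close>, and that distance is at most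
  the asymptotic semi-norm of the orbit sum.
\<close>

lemma orbit_sum_null_iff: "S v \<in> N \<longleftrightarrow> v \<in> cL"
proof
  assume "S v \<in> N"
  then have "nrm (S v) = 0" by (simp add: null_set_maps_def)
  then have q: "(INF a\<in>v +o L. p a) \<le> 0"
    using quotient_seminorm_le_orbit_sum[OF subset_refl, of v] by (simp add: quotient_seminorm_def)
  have L: "subspace L" by (simp add: cobound_def)
  have ne: "v +o L \<noteq> {}"
    using subspace_0[OF L] by (auto simp: elt_set_plus_def)
  show "v \<in> cL"
    unfolding cobound_closure_iff
  proof (intro allI impI)
    fix e :: real assume "e > 0"
    with q have "(INF a\<in>v +o L. p a) < e" by simp
    then obtain a where a: "a \<in> v +o L" "p a < e"
      by (subst (asm) cINF_less_iff[OF ne bdd_belowI2[of _ 0]]) (auto intro: seminorm_nonneg[OF p])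
    then have "a - v \<in> L" by (simp add: mem_elt_set_plus_iff)
    then have "v - a \<in> L" using subspace_neg[OF L] by fastforce
    with a show "\<exists>l\<in>L. p (v - l) < e" by (intro bexI[of _ "v - a"]) auto
  qed
qed (rule orbit_sum_cobound_closure)

section \<open>The map induced on the quotient\<close>

lemma orbit_sum_quotient_coset:
  assumes U: "subspace U" "U \<subseteq> cL"
  shows "orbit_sum_quotient G p \<pi> (v +o U) = S v +o N"
proof -
  have const: "S w +o N = S v +o N" if "w \<in> v +o U" for w
  proof -
    have "S (w - v) \<in> N"
      using that U by (intro orbit_sum_cobound_closure) (auto simp: mem_elt_set_plus_iff)
    then show ?thesis
      by (simp add: coset_eq_iff[OF subspace_null_set_maps] linear_diff[OF linear_orbit_sum])
  qed
  have "v \<in> v +o U"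
    using subspace_0[OF U(1)] by (simp add: mem_elt_set_plus_iff)
  then have "(\<lambda>w. S w +o N) ` (v +o U) = {S v +o N}"
    by (rule image_eq_singleton) (rule const)
  then show ?thesis unfolding orbit_sum_quotient_def by simp
qed

lemma set_map_norm_orbit_sum: "set_map_norm G p (S v +o N) = nrm (S v)"
  by (rule set_map_norm_coset[OF orbit_sum_set_map])

context
  fixes U :: "'v set"
  assumes U: "subspace U" "U \<subseteq> cL"
begin

abbreviation "Sq \<equiv> orbit_sum_quotient G p \<pi>"
abbreviation "X \<equiv> quotient_space UNIV U"
abbreviation "Y \<equiv> quotient_space (additive_set_maps G p \<pi>) N"

lemmas Sq = orbit_sum_quotient_coset[OF U]

lemma coset_linear_orbit_sum_quotient: "coset_linear U N X Sq"
proof -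
  note ops = coset_operations[OF U(1)] and N_ops = coset_operations[OF subspace_null_set_maps]
  have "Sq ((v +o U) + (w +o U)) = Sq (v +o U) + Sq (w +o U)" for v w
    by (simp only: ops(1) Sq N_ops(1) linear_add[OF linear_orbit_sum])
  moreover have "Sq (coset_scale U c (v +o U)) = coset_scale N c (Sq (v +o U))" for c v
    by (simp only: ops(2) Sq N_ops(2) linear_scale[OF linear_orbit_sum])
  ultimately show ?thesis
    unfolding coset_linear_def quotient_space_def by blast
qed

lemma orbit_sum_quotient_image: "Sq ` X = Y"
proof -
  have "range S = additive_set_maps G p \<pi>"
    using additive_orbit_sum additive_set_map_eq_orbit_sum by blast
  then have "Y = (\<lambda>\<phi>. \<phi> +o N) ` range S" unfolding quotient_space_def by simp
  then show ?thesis by (simp only: quotient_space_def image_image Sq)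
qed

lemma coset_diff_orbit_sum:
  "coset_diff N (Sq (v +o U)) (Sq (w +o U)) = S (v - w) +o N"
  by (simp only: Sq coset_operations(3)[OF subspace_null_set_maps] linear_diff[OF linear_orbit_sum])

lemma continuous_orbit_sum_quotient:
  "continuous_map (coset_topology U X (quotient_seminorm p))
     (coset_topology N Y (set_map_norm G p)) Sq"
  unfolding coset_topology_def
proof (rule continuous_map_pseudodist_topology[OF _ C_pos])
  fix A B assume "A \<in> X" "B \<in> X"
  then obtain v w where A: "A = v +o U" and B: "B = w +o U"
    by (auto simp: quotient_space_def)
  show "set_map_norm G p (coset_diff N (Sq A) (Sq B)) \<le> C * quotient_seminorm p (coset_diff U A B)"
    unfolding A B coset_diff_orbit_sum coset_operations(3)[OF U(1)] set_map_norm_orbit_sum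
    by (rule orbit_sum_seminorm_le_quotient[OF U])
qed (simp add: orbit_sum_quotient_image)

lemma orbit_sum_quotient_bij:
  assumes "U = cL"
  shows "bij_betw Sq X Y"
proof -
  have "v +o U = w +o U" if "Sq (v +o U) = Sq (w +o U)" for v w
  proof -
    have "S (v - w) \<in> N"
      using that
      by (simp add: Sq coset_eq_iff[OF subspace_null_set_maps] linear_diff[OF linear_orbit_sum])
    then have "v - w \<in> U"
      using assms by (simp add: orbit_sum_null_iff)
    then show ?thesis
      by (simp add: coset_eq_iff[OF U(1)])
  qed
  then have "inj_on Sq X"
    unfolding inj_on_def quotient_space_def by blast
  then show ?thesis by (simp add: bij_betw_def orbit_sum_quotient_image)
qed

lemma continuous_orbit_sum_quotient_inv:
  assumes "U = cL"
  shows "continuous_map (coset_topology N Y (set_map_norm G p))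
     (coset_topology U X (quotient_seminorm p)) (inv_into X Sq)"
  unfolding coset_topology_def
proof (rule continuous_map_pseudodist_topology[OF _ zero_less_one])
  note bij = orbit_sum_quotient_bij[OF assms]
  show "inv_into X Sq ` Y \<subseteq> X"
    using bij_betw_inv_into[OF bij] by (simp add: bij_betw_def)
  fix \<Phi> \<Psi> assume "\<Phi> \<in> Y" "\<Psi> \<in> Y"
  then obtain A B where A: "A \<in> X" "\<Phi> = Sq A" and B: "B \<in> X" "\<Psi> = Sq B"
    unfolding orbit_sum_quotient_image[symmetric] by blast
  then obtain v w where v: "A = v +o U" and w: "B = w +o U"
    by (auto simp: quotient_space_def)
  have inv: "inv_into X Sq (Sq A) = A" "inv_into X Sq (Sq B) = B"
    using bij A B by (auto simp: bij_betw_def)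
  have "quotient_seminorm p (coset_diff U A B) \<le> set_map_norm G p (coset_diff N (Sq A) (Sq B))"
    unfolding v w coset_diff_orbit_sum coset_operations(3)[OF U(1)] set_map_norm_orbit_sum
    by (rule quotient_seminorm_le_orbit_sum) (simp add: assms cobound_subset_closure)
  then show "quotient_seminorm p (coset_diff U (inv_into X Sq \<Phi>) (inv_into X Sq \<Psi>))
      \<le> 1 * set_map_norm G p (coset_diff N \<Phi> \<Psi>)"
    by (simp add: A(2) B(2) inv)
qed

lemma orbit_sum_quotient_isometry:
  assumes "U = cL" and "C = 1" and "A \<in> X"
  shows "set_map_norm G p (Sq A) = quotient_seminorm p A"
proof -
  obtain v where v: "A = v +o U" using assms(3) by (auto simp: quotient_space_def)
  have "nrm (S v) \<le> quotient_seminorm p (v +o U)"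
    using orbit_sum_seminorm_le_quotient[OF U, of v] assms(2) by simp
  moreover have "quotient_seminorm p (v +o U) \<le> nrm (S v)"
    by (rule quotient_seminorm_le_orbit_sum) (simp add: assms cobound_subset_closure)
  ultimately show ?thesis by (simp add: v Sq set_map_norm_orbit_sum)
qed

end

end

section \<open>The uniform bound of a representation\<close>

text \<open>
  The operator norm is a supremum over the unit ball; the pointwise bound needs a separate argument
  for vectors with \<open>p v = 0\<close>, which cannot be normalised.
\<close>

lemma opnorm_bound:
  fixes p :: "'v::real_vector \<Rightarrow> real"
  assumes p: "is_seminorm p" and T: "bounded_operator p T"
  shows "p (T v) \<le> opnorm p T * p v"
proof -
  obtain A where A: "\<And>v. p (T v) \<le> A * p v" and lin: "linear T"
    using T by (auto simp: bounded_operator_def)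
  show ?thesis
  proof (cases "p v = 0")
    case True
    then show ?thesis using A[of v] by simp
  next
    case False
    then have pos: "p v > 0" using seminorm_nonneg[OF p, of v] by simp
    have "p (T u) \<le> \<bar>A\<bar>" if "p u \<le> 1" for u
    proof -
      have "A * p u \<le> \<bar>A\<bar> * 1"
        using that seminorm_nonneg[OF p, of u] by (intro mult_mono) auto
      then show ?thesis using A[of u] by simp
    qed
    then have "bdd_above ((\<lambda>v. p (T v)) ` {v. p v \<le> 1})"
      by (intro bdd_aboveI2[of _ _ "\<bar>A\<bar>"]) auto
    then have "p (T (inverse (p v) *\<^sub>R v)) \<le> opnorm p T"
      unfolding opnorm_def
      by (rule cSUP_upper[rotated]) (use pos in \<open>simp add: seminorm_rules(2)[OF p]\<close>)
    then show ?thesis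
      using pos by (simp add: linear_scale[OF lin] seminorm_rules(2)[OF p] field_simps)
  qed
qed

lemma uniformly_bounded_obtains:
  fixes p :: "'v::real_vector \<Rightarrow> real"
  assumes p: "is_seminorm p" and rep: "\<pi> \<in> hom G (Isom p)" and ub: "uniformly_bounded G p \<pi>"
  obtains C where "C > 0" "\<And>g v. g \<in> carrier G \<Longrightarrow> p (\<pi> g v) \<le> C * p v"
proof -
  obtain B where B: "\<And>g. g \<in> carrier G \<Longrightarrow> opnorm p (\<pi> g) \<le> B"
    using ub by (auto simp: uniformly_bounded_def bdd_above_def)
  show thesis
  proof (rule that[of "max B 1"])
    fix g v assume g: "g \<in> carrier G"
    then have "bounded_operator p (\<pi> g)"
      using rep by (auto simp: hom_def Isom_def)
    then have "p (\<pi> g v) \<le> opnorm p (\<pi> g) * p v" by (rule opnorm_bound[OF p])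
    also have "\<dots> \<le> max B 1 * p v"
      using B[OF g] by (intro mult_right_mono seminorm_nonneg p) auto
    finally show "p (\<pi> g v) \<le> max B 1 * p v" .
  qed simp
qed

section \<open>The isomorphism theorem\<close>

theorem theorem3p7:
  fixes G :: "('g, 'm) monoid_scheme"
    and p :: "'v::real_vector \<Rightarrow> real"
    and \<pi> :: "'g \<Rightarrow> 'v \<Rightarrow> 'v"
    and U :: "'v set"
  defines "N \<equiv> null_set_maps G p \<pi>"
    and "S \<equiv> orbit_sum_quotient G p \<pi>"
    and "X \<equiv> quotient_space UNIV U"
    and "Y \<equiv> quotient_space (additive_set_maps G p \<pi>) (null_set_maps G p \<pi>)"
    and "TX \<equiv> coset_topology U (quotient_space UNIV U) (quotient_seminorm p)"
    and "TY \<equiv> coset_topology (null_set_maps G p \<pi>)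
                (quotient_space (additive_set_maps G p \<pi>) (null_set_maps G p \<pi>))
                (set_map_norm G p)"
  assumes "group G" and "countable (carrier G)" and "amenable G"
    and "is_seminorm p" and "seminorm_complete p"
    and "\<pi> \<in> hom G (Isom p)" and "uniformly_bounded G p \<pi>"
    and "subspace U" and "U \<subseteq> cobound_closure G p \<pi>"
  shows "(\<forall>v. S (v +o U) = orbit_sum G \<pi> v +o N) \<and>
         coset_linear U N X S \<and> S ` X = Y \<and> continuous_map TX TY S \<and>
         (U = cobound_closure G p \<pi> \<longrightarrow>
            bij_betw S X Y \<and> continuous_map TY TX (inv_into X S) \<and>
            (isometric_rep G p \<pi> \<longrightarrow> (\<forall>A\<in>X. set_map_norm G p (S A) = quotient_seminorm p A)))"
proof -
  note defs = N_def S_def X_def Y_def TX_def TY_def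
  have G: "amenable_group G"
    using assms by (simp add: amenable_group_def amenable_group_axioms_def)
  note U = \<open>subspace U\<close> \<open>U \<subseteq> cobound_closure G p \<pi>\<close>
  obtain C where C: "C > 0" "\<And>g v. g \<in> carrier G \<Longrightarrow> p (\<pi> g v) \<le> C * p v"
    using uniformly_bounded_obtains assms by blast
  interpret amenable_rep G p \<pi> C
    using G assms C by (simp add: amenable_rep_def amenable_rep_axioms_def)
  have "set_map_norm G p (S A) = quotient_seminorm p A"
    if iso: "isometric_rep G p \<pi>" and eq: "U = cobound_closure G p \<pi>" and A: "A \<in> X" for A
  proof -
    interpret iso: amenable_rep G p \<pi> 1
      using G assms iso by (simp add: amenable_rep_def amenable_rep_axioms_def isometric_rep_def)
    show ?thesis
      using iso.orbit_sum_quotient_isometry[OF U eq refl, of A] A by (simp add: defs)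
  qed
  then show ?thesis
    using orbit_sum_quotient_coset[OF U] coset_linear_orbit_sum_quotient[OF U]
      orbit_sum_quotient_image[OF U] continuous_orbit_sum_quotient[OF U]
      orbit_sum_quotient_bij[OF U] continuous_orbit_sum_quotient_inv[OF U]
    unfolding defs by blast
qed

end
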